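(* Let $f$ be a polynomial of degree $d\ge 2$ with coefficients in $\mathcal{O}_p$ and leading coefficient in $\mathcal{O}_p^{*}$, and let $\phi:\mathbb{P}^1(\mathbb{C}_p)\to\mathbb{P}^1(\mathbb{C}_p)$ be the corresponding morphism $\phi[x,y]=[y^df(x/y),y^d]$ (which then has good reduction). Then for every $q\in\mathbb{C}_p$, $$\lambda_{\phi,p}(q)=\log^{+}|q|=\lim_{n\to\infty}\frac{1}{d^n}\sum_{\xi\neq q:\ f^{(n)}(\xi)=\xi}\log|\xi-q|,$$ where the sum is over the solutions $\xi\in\mathbb{C}_p$, $\xi\ne q$, of $f^{(n)}(\xi)=\xi$, taken with multiplicities.
   Context: $p$ is a prime, $\mathbb{C}_p$ is the completion of the algebraic closure of $\mathbb{Q}_p$, $|\cdot|$ is the extension of the $p$-adic norm to $\mathbb{C}_p$ (so $|p|=1/p$), and $\mathcal{O}_p=\{x\in\mathbb{C}_p:|x|\le 1\}$ is its ring of integral elements, with unit group $\mathcal{O}_p^*$. $f^{(n)}$ denotes the $n$-th iterate of $f$. $\log^+ t=\max\{0,\log t\}$ for $t\geq 0$ (with $\log^+0=0$). For a morphism given by a polynomial, good reduction means that the polynomial has coefficients in $\mathcal{O}_p$ and leading coefficient in $\mathcal{O}_p^*$. The local canonical morphic height is $$\lambda_{\phi,p}(q)=\lim_{n\to\infty}\frac1{d^n}\log^+|f^{(n)}(q)|.$$ The multiplicity of $\xi$ in the sum is its multiplicity as a root of the polynomial $f^{(n)}(x)-x$. *)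

theory Defs
  imports "HOL-Analysis.Analysis" "HOL-Computational_Algebra.Computational_Algebra"
begin

section \<open>The field of p-adic complex numbers\<close>

definition padic_abs :: "nat \<Rightarrow> rat \<Rightarrow> real" where
  "padic_abs p r =
     (if r = 0 then 0
      else real p powi (int (multiplicity (int p) (snd (quotient_of r)))
                        - int (multiplicity (int p) (fst (quotient_of r)))))"

locale nonarch_absolute_value =
  fixes absv :: "'a::field \<Rightarrow> real"
  assumes absv_nonneg: "0 \<le> absv x"
    and absv_eq_0_iff: "absv x = 0 \<longleftrightarrow> x = 0"
    and absv_mult: "absv (x * y) = absv x * absv y"
    and absv_ultrametric: "absv (x + y) \<le> max (absv x) (absv y)"
begin

lemma absv_1 [simp]: "absv 1 = 1"
  using absv_mult[of 1 1] absv_eq_0_iff[of 1] by simp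

lemma absv_minus [simp]: "absv (- x) = absv x"
proof -
  have "absv (- 1) * absv (- 1) = 1"
    using absv_mult[of "- 1" "- 1"] by simp
  then have "absv (- 1) = 1"
    using absv_nonneg[of "- 1"] by (simp add: square_eq_1_iff)
  then show ?thesis
    using absv_mult[of "- 1" x] by simp
qed

sublocale metr: Metric_space UNIV "\<lambda>x y. absv (x - y)"
proof
  show "0 \<le> absv (x - y)" for x y by (rule absv_nonneg)
  show "absv (x - y) = absv (y - x)" for x y
    using absv_minus[of "x - y"] by simp
  show "absv (x - y) = 0 \<longleftrightarrow> x = y" for x y by (simp add: absv_eq_0_iff)
  show "absv (x - z) \<le> absv (x - y) + absv (y - z)" for x y z
    using absv_ultrametric[of "x - y" "y - z"] absv_nonneg[of "x - y"] absv_nonneg[of "y - z"]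
    by simp
qed

end

definition algebraic_elements :: "'a::field set \<Rightarrow> 'a set" where
  "algebraic_elements F = {x. \<exists>g. g \<noteq> 0 \<and> (\<forall>i. coeff g i \<in> F) \<and> poly g x = 0}"

definition algebraically_closed :: "'a::field set \<Rightarrow> bool" where
  "algebraically_closed L \<longleftrightarrow>
     (\<forall>g. (\<forall>i. coeff g i \<in> L) \<and> degree g > 0 \<longrightarrow> (\<exists>x\<in>L. poly g x = 0))"

definition rational_closure :: "('a::field_char_0 \<Rightarrow> real) \<Rightarrow> 'a set" where
  "rational_closure absv = Metric_space.mtopology UNIV (\<lambda>x y. absv (x - y)) closure_of \<rat>"

text \<open>
  The type \<open>'a\<close> with \<open>absv\<close> is a completion of an algebraic closure of a completion of the
  rationals with respect to the \<open>p\<close>-adic absolute value, which determines it up to isometric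
  isomorphism.  Since \<open>'a\<close> is complete, the closure \<open>Qp\<close> of the rationals in \<open>'a\<close> is a completion
  of the rationals.  Its algebraic elements are an algebraic closure of \<open>Qp\<close> as soon as they
  are algebraically closed.  Finally \<open>'a\<close> is a completion of this algebraic closure, because it
  is complete and the algebraic closure is dense.
\<close>

locale padic_complex_field = nonarch_absolute_value absv
  for p :: nat and absv :: "'a::field_char_0 \<Rightarrow> real" +
  assumes prime_p: "prime p"
    and absv_of_rat: "absv (of_rat r) = padic_abs p r"
    and complete: "metr.mcomplete"
    and closed: "algebraically_closed (algebraic_elements (rational_closure absv))"
    and dense: "metr.mtopology closure_of (algebraic_elements (rational_closure absv)) = UNIV"

definition integral_elements :: "('a::field \<Rightarrow> real) \<Rightarrow> 'a set" where
  "integral_elements absv = {x. absv x \<le> 1}"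

definition integral_units :: "('a::field \<Rightarrow> real) \<Rightarrow> 'a set" where
  "integral_units absv =
     {x \<in> integral_elements absv. \<exists>y \<in> integral_elements absv. x * y = 1}"


section \<open>Morphisms of the projective line given by polynomials\<close>

definition proj_rel :: "'a::field \<times> 'a \<Rightarrow> 'a \<times> 'a \<Rightarrow> bool" where
  "proj_rel u v \<longleftrightarrow>
     u \<noteq> (0, 0) \<and> v \<noteq> (0, 0) \<and> (\<exists>c. c \<noteq> 0 \<and> v = (c * fst u, c * snd u))"

lemma part_equivp_proj_rel: "part_equivp (proj_rel :: 'a::field \<times> 'a \<Rightarrow> _)"
proof (rule part_equivpI)
  show "\<exists>x :: 'a \<times> 'a. proj_rel x x"
    by (rule exI[of _ "(0, 1)"]) (auto simp: proj_rel_def intro: exI[of _ 1])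
  show "symp (proj_rel :: 'a \<times> 'a \<Rightarrow> _)"
  proof (rule sympI)
    fix u v :: "'a \<times> 'a"
    assume "proj_rel u v"
    then obtain c where "u \<noteq> (0, 0)" "v \<noteq> (0, 0)" "c \<noteq> 0" "v = (c * fst u, c * snd u)"
      unfolding proj_rel_def by blast
    moreover have "fst u = inverse c * (c * fst u)" "snd u = inverse c * (c * snd u)"
      using \<open>c \<noteq> 0\<close> by (simp_all add: mult.assoc [symmetric])
    ultimately have "v \<noteq> (0, 0)" "u \<noteq> (0, 0)" "inverse c \<noteq> 0"
        "u = (inverse c * fst v, inverse c * snd v)"
      using \<open>proj_rel u v\<close> by (auto simp: proj_rel_def intro: prod_eqI)
    then show "proj_rel v u"
      unfolding proj_rel_def by blast
  qed
  show "transp (proj_rel :: 'a \<times> 'a \<Rightarrow> _)"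
  proof (rule transpI)
    fix u v w :: "'a \<times> 'a"
    assume "proj_rel u v" "proj_rel v w"
    then obtain c e where "u \<noteq> (0, 0)" "w \<noteq> (0, 0)"
      "c \<noteq> 0" "v = (c * fst u, c * snd u)" "e \<noteq> 0" "w = (e * fst v, e * snd v)"
      unfolding proj_rel_def by blast
    then show "proj_rel u w"
      unfolding proj_rel_def by (auto intro!: exI[of _ "e * c"] simp: mult_ac)
  qed
qed

quotient_type (overloaded) 'a proj_line = "'a::field \<times> 'a" / partial: proj_rel
  by (rule part_equivp_proj_rel)

text \<open>The form \<open>y ^ d * f (x / y)\<close> with \<open>d = degree f\<close>, written so that it is defined for \<open>y = 0\<close>.\<close>

definition homogenize :: "'a::field poly \<Rightarrow> 'a \<Rightarrow> 'a \<Rightarrow> 'a" where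
  "homogenize f x y = (\<Sum>i\<le>degree f. coeff f i * x ^ i * y ^ (degree f - i))"

lemma homogenize_eq:
  assumes "y \<noteq> 0"
  shows "homogenize f x y = y ^ degree f * poly f (x / y)"
  unfolding homogenize_def poly_altdef sum_distrib_left
  by (intro sum.cong) (use assms in \<open>auto simp: field_simps simp flip: power_add\<close>)

lemma homogenize_0_right: "homogenize f x 0 = lead_coeff f * x ^ degree f"
proof -
  have "homogenize f x 0 =
    (\<Sum>i\<le>degree f. if i = degree f then coeff f i * x ^ i else 0)"
    unfolding homogenize_def by (intro sum.cong) auto
  then show ?thesis by simp
qed

lemma homogenize_scale: "homogenize f (c * x) (c * y) = c ^ degree f * homogenize f x y"
proof -
  have "coeff f i * (c * x) ^ i * (c * y) ^ (degree f - i) =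
      c ^ degree f * (coeff f i * x ^ i * y ^ (degree f - i))" if "i \<le> degree f" for i
  proof -
    have "c ^ degree f = c ^ i * c ^ (degree f - i)"
      using that by (simp flip: power_add)
    then show ?thesis by (simp add: power_mult_distrib)
  qed
  then show ?thesis
    unfolding homogenize_def sum_distrib_left by (intro sum.cong) auto
qed

lift_definition polynomial_morphism :: "'a::field poly \<Rightarrow> 'a proj_line \<Rightarrow> 'a proj_line"
  is "\<lambda>f (x, y). (homogenize f x y, y ^ degree f)"
proof -
  fix f :: "'a poly" and u v :: "'a \<times> 'a"
  assume "proj_rel u v"
  then obtain x y c where u: "u = (x, y)" "(x, y) \<noteq> (0, 0)" and c: "c \<noteq> 0" "v = (c * x, c * y)"
    by (cases u) (auto simp: proj_rel_def)
  have "(homogenize f x y, y ^ degree f) \<noteq> (0, 0)"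
    using u by (cases "y = 0") (auto simp: homogenize_0_right)
  then show "proj_rel (case u of (x, y) \<Rightarrow> (homogenize f x y, y ^ degree f))
                      (case v of (x, y) \<Rightarrow> (homogenize f x y, y ^ degree f))"
    using u c
    by (auto simp: proj_rel_def homogenize_scale power_mult_distrib intro!: exI[of _ "c ^ degree f"])
qed

definition polynomial_of :: "('a::field proj_line \<Rightarrow> 'a proj_line) \<Rightarrow> 'a poly" where
  "polynomial_of \<phi> = (THE f. polynomial_morphism f = \<phi>)"

lift_definition affine_point :: "'a::field \<Rightarrow> 'a proj_line" is "\<lambda>x. (x, 1)"
  by (auto simp: proj_rel_def intro: exI[of _ 1])

lemma affine_point_eq_iff: "affine_point x = affine_point y \<longleftrightarrow> x = y"
  by transfer (auto simp: proj_rel_def)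

lemma polynomial_morphism_affine:
  "polynomial_morphism f (affine_point x) = affine_point (poly f x)"
  by transfer (auto simp: proj_rel_def homogenize_eq intro: exI[of _ 1])

lemma polynomial_of_polynomial_morphism [simp]:
  fixes f :: "'a::field_char_0 poly"
  shows "polynomial_of (polynomial_morphism f) = f"
  unfolding polynomial_of_def
proof (rule the_equality)
  fix g assume "polynomial_morphism g = polynomial_morphism f"
  then have "affine_point (poly g x) = affine_point (poly f x)" for x
    by (simp flip: polynomial_morphism_affine)
  then show "g = f"
    by (simp add: affine_point_eq_iff fun_eq_iff flip: poly_eq_poly_eq_iff)
qed simp


section \<open>Heights and periodic points\<close>

definition log_plus :: "real \<Rightarrow> real" where
  "log_plus t = (if t = 0 then 0 else max 0 (ln t))"

definition local_height_approx ::
    "('a::field \<Rightarrow> real) \<Rightarrow> ('a proj_line \<Rightarrow> 'a proj_line) \<Rightarrow> 'a \<Rightarrow> nat \<Rightarrow> real" where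
  "local_height_approx absv \<phi> q n =
     (let f = polynomial_of \<phi>
      in 1 / real (degree f) ^ n * log_plus (absv ((poly f ^^ n) q)))"

definition local_height ::
    "('a::field \<Rightarrow> real) \<Rightarrow> ('a proj_line \<Rightarrow> 'a proj_line) \<Rightarrow> 'a \<Rightarrow> real" where
  "local_height absv \<phi> q = lim (local_height_approx absv \<phi> q)"

definition iterate_poly :: "'a::comm_ring_1 poly \<Rightarrow> nat \<Rightarrow> 'a poly" where
  "iterate_poly f n = ((\<lambda>g. pcompose f g) ^^ n) [:0, 1:]"

lemma poly_iterate_poly: "poly (iterate_poly f n) x = (poly f ^^ n) x"
  by (induction n) (simp_all add: iterate_poly_def poly_pcompose)

definition periodic_multiplicity :: "'a::field poly \<Rightarrow> nat \<Rightarrow> 'a \<Rightarrow> nat" where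
  "periodic_multiplicity f n \<xi> = order \<xi> (iterate_poly f n - [:0, 1:])"

end

theory Submission
  imports Defs "HOL-Real_Asymp.Real_Asymp"
begin

text \<open>
  As the leading coefficient is a unit and \<open>\<complex>\<^sub>p\<close> is algebraically closed, the sum over the
  periodic points is \<open>log L(f\<^sup>n - X)\<close>, where \<open>L(P)\<close> is the absolute value of \<open>P / (x - q)\<^sup>m\<close>
  at \<open>q\<close> and \<open>m\<close> is the order of vanishing of \<open>P\<close> at \<open>q\<close>. If \<open>\<bar>q\<bar> > 1\<close>, then
  \<open>\<bar>f\<^sup>n(q)\<bar>\<close> is the \<open>d\<^sup>n\<close>-th power of \<open>\<bar>q\<bar>\<close> and dominates \<open>\<bar>q\<bar>\<close>.

  If \<open>\<bar>q\<bar> \<le> 1\<close>, then \<open>L(f\<^sup>n - X) \<le> 1\<close>, and it suffices to show \<open>L(f\<^sup>n - X) \<ge> c / n\<close> for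
  some \<open>c > 0\<close>. Since \<open>g - X\<close> divides \<open>g\<^sup>k - X\<close> with an integral quotient,
  \<open>L(f\<^sup>n - X) \<ge> L((f\<^sup>M)\<^sup>n - X)\<close> for every \<open>M\<close>. Unless \<open>\<bar>f\<^sup>m(q) - q\<bar> > p\<^sup>-\<^sup>2\<close> for all \<open>m\<close>,
  choose \<open>m\<close> violating this and let \<open>g = f\<^sup>m\<close> and \<open>\<mu> = g'(q)\<close>; the quotient of \<open>g\<^sup>n - X\<close> by
  \<open>g - X\<close> at \<open>q\<close> is \<open>1 + \<mu> + \<dots> + \<mu>\<^sup>n\<^sup>-\<^sup>1\<close> up to \<open>p\<^sup>-\<^sup>2\<close>. Either no power of \<open>\<mu>\<close> is
  within \<open>p\<^sup>-\<^sup>2\<close> of \<open>1\<close>, and this is bounded below by \<open>p\<^sup>-\<^sup>2\<close>; or some \<open>\<mu>\<^sup>j\<close> is, and for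
  \<open>M = m j\<close> the quotient has absolute value \<open>\<bar>n\<bar> \<ge> 1 / n\<close>.
\<close>

section \<open>Nonarchimedean absolute values and polynomials\<close>

context nonarch_absolute_value
begin

lemma absv_0 [simp]: "absv 0 = 0"
  by (simp add: absv_eq_0_iff)

lemma absv_pos_iff: "0 < absv x \<longleftrightarrow> x \<noteq> 0"
  using absv_nonneg[of x] absv_eq_0_iff[of x] by linarith

lemma absv_power: "absv (x ^ n) = absv x ^ n"
  by (induction n) (simp_all add: absv_mult)

lemma absv_diff_commute: "absv (x - y) = absv (y - x)"
  using absv_minus[of "x - y"] by simp

lemma absv_add_le: "absv x \<le> c \<Longrightarrow> absv y \<le> c \<Longrightarrow> absv (x + y) \<le> c"
  using absv_ultrametric[of x y] by linarith

lemma absv_diff_le: "absv x \<le> c \<Longrightarrow> absv y \<le> c \<Longrightarrow> absv (x - y) \<le> c"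
  using absv_add_le[of x c "- y"] by simp

lemma absv_diff_trans: "absv (x - y) \<le> c \<Longrightarrow> absv (y - z) \<le> c \<Longrightarrow> absv (x - z) \<le> c"
  using absv_add_le[of "x - y" c "y - z"] by simp

lemma absv_mult_le: "absv x \<le> a \<Longrightarrow> absv y \<le> b \<Longrightarrow> absv (x * y) \<le> a * b"
  unfolding absv_mult using absv_nonneg[of x] absv_nonneg[of y] by (intro mult_mono) simp_all

lemma absv_mult_le_left: "absv x \<le> 1 \<Longrightarrow> absv y \<le> c \<Longrightarrow> absv (x * y) \<le> c"
  using absv_mult_le[of x 1 y c] by simp

lemma absv_mult_le_right: "absv x \<le> c \<Longrightarrow> absv y \<le> 1 \<Longrightarrow> absv (x * y) \<le> c"
  using absv_mult_le[of x c y 1] by simp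

lemma absv_power_le_1: "absv x \<le> 1 \<Longrightarrow> absv (x ^ n) \<le> 1"
  by (simp add: absv_power absv_nonneg power_le_one)

lemma absv_sum_le: "(\<And>i. i \<in> I \<Longrightarrow> absv (u i) \<le> c) \<Longrightarrow> 0 \<le> c \<Longrightarrow> absv (\<Sum>i\<in>I. u i) \<le> c"
  by (induction I rule: infinite_finite_induct) (auto intro: absv_add_le)

text \<open>Isosceles principle: writing \<open>x\<close> as \<open>(x + y) - y\<close> shows that a
  strictly larger summand cannot be cancelled.\<close>

lemma absv_add_eq: "absv y < absv x \<Longrightarrow> absv (x + y) = absv x"
  using absv_ultrametric[of x y] absv_ultrametric[of "x + y" "- y"] by simp

lemma absv_eq_of_close: "absv (x - y) < absv y \<Longrightarrow> absv x = absv y"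
  using absv_add_eq[of "x - y" y] by simp

lemma absv_power_diff_le:
  assumes "absv x \<le> 1" "absv y \<le> 1" "absv (x - y) \<le> c"
  shows "absv (x ^ n - y ^ n) \<le> c"
proof (induction n)
  case 0
  show ?case using order_trans[OF absv_nonneg assms(3)] by simp
next
  case (Suc n)
  have "x ^ Suc n - y ^ Suc n = (x - y) * x ^ n + y * (x ^ n - y ^ n)"
    by (simp add: algebra_simps)
  then show ?case
    using assms Suc
    by (simp add: absv_add_le absv_mult_le_right absv_power_le_1 absv_mult_le_left)
qed

text \<open>For \<open>1 < absv x\<close> the terms below the top one contribute at most
  \<open>absv x\<close> to the power \<open>degree P - 1\<close>, so the top term alone
  decides.\<close>

lemma absv_monic_poly_dominant:
  assumes "1 < absv x" "\<And>i. absv (coeff P i) \<le> 1" "absv (lead_coeff P) = 1"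
  shows "absv (poly P x) = absv x ^ degree P"
proof (cases "degree P")
  case 0
  then show ?thesis using assms(3) degree_eq_zeroE[OF 0] by fastforce
next
  case (Suc m)
  have *: "poly P x = lead_coeff P * x ^ degree P + (\<Sum>i\<le>m. coeff P i * x ^ i)"
    unfolding poly_altdef Suc by simp
  have "absv (\<Sum>i\<le>m. coeff P i * x ^ i) \<le> absv x ^ m"
  proof (rule absv_sum_le)
    fix i assume "i \<in> {..m}"
    then have "absv (x ^ i) \<le> absv x ^ m"
      using assms(1) by (simp add: absv_power power_increasing)
    then show "absv (coeff P i * x ^ i) \<le> absv x ^ m"
      using assms(2) by (rule absv_mult_le_left[rotated])
  qed (use assms(1) in simp)
  also have "\<dots> < absv x ^ degree P"
    using assms(1) Suc by (simp add: power_strict_increasing)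
  also have "\<dots> = absv (lead_coeff P * x ^ degree P)"
    by (simp add: absv_mult absv_power assms(3))
  finally show ?thesis
    unfolding * by (subst absv_add_eq) (simp_all add: absv_mult absv_power assms(3))
qed

lemma absv_poly_le:
  assumes "\<And>i. absv (coeff P i) \<le> c" "absv x \<le> t" "1 \<le> t"
  shows "absv (poly P x) \<le> c * t ^ degree P"
  unfolding poly_altdef
proof (rule absv_sum_le)
  fix i assume "i \<in> {..degree P}"
  then have "absv x ^ i \<le> t ^ degree P"
    using assms(2,3) absv_nonneg[of x] power_mono[of "absv x" t i] power_increasing[of i "degree P" t]
    by simp
  then show "absv (coeff P i * x ^ i) \<le> c * t ^ degree P"
    by (intro absv_mult_le) (simp_all add: assms(1) absv_power)
next
  show "0 \<le> c * t ^ degree P"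
    using assms(1)[of 0] absv_nonneg[of "coeff P 0"] assms(3) by simp
qed

text \<open>A Lipschitz estimate near \<open>x\<close>, by Horner recursion on \<open>P\<close>. It
  carries approximate roots to their limit in \<open>ex_root\<close>.\<close>

lemma poly_absv_continuous:
  "\<exists>c\<ge>0. \<forall>y. absv (x - y) \<le> 1 \<longrightarrow> absv (poly P x - poly P y) \<le> c * absv (x - y)"
proof (induction P)
  case 0
  show ?case by (auto intro: exI[of _ 0])
next
  case (pCons a P)
  then obtain c where c: "0 \<le> c" "\<And>y. absv (x - y) \<le> 1 \<Longrightarrow> absv (poly P x - poly P y) \<le> c * absv (x - y)"
    by blast
  define t where "t = max 1 (absv x)"
  define u where "u = max (absv (poly P x)) (t * c)"
  have "absv (poly (pCons a P) x - poly (pCons a P) y) \<le> u * absv (x - y)"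
    if "absv (x - y) \<le> 1" for y
  proof -
    have *: "poly (pCons a P) x - poly (pCons a P) y = poly P x * (x - y) + y * (poly P x - poly P y)"
      by (simp add: algebra_simps)
    have y: "absv y \<le> t"
      using absv_diff_le[of x t "x - y"] that by (simp add: t_def)
    have "absv (y * (poly P x - poly P y)) \<le> t * (c * absv (x - y))"
      using y c(2)[OF that] by (rule absv_mult_le)
    also have "\<dots> \<le> u * absv (x - y)"
      using absv_nonneg[of "x - y"] by (simp add: u_def mult.assoc [symmetric] mult_right_mono)
    finally have "absv (y * (poly P x - poly P y)) \<le> u * absv (x - y)" .
    moreover have "absv (poly P x * (x - y)) \<le> u * absv (x - y)"
      unfolding absv_mult using absv_nonneg[of "x - y"] by (simp add: u_def mult_right_mono)
    ultimately show ?thesis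
      unfolding * by (intro absv_add_le)
  qed
  moreover have "0 \<le> u" using absv_nonneg[of "poly P x"] by (simp add: u_def)
  ultimately show ?case by blast
qed

lemma closure_of_iff:
  "x \<in> metr.mtopology closure_of S \<longleftrightarrow> (\<forall>r>0. \<exists>y\<in>S. absv (x - y) < r)"
  by (simp add: metr.metric_closure_of)

section \<open>Polynomials over the ring of integral elements\<close>

definition integral_poly :: "'a poly \<Rightarrow> bool" where
  "integral_poly P \<longleftrightarrow> (\<forall>i. absv (coeff P i) \<le> 1)"

lemma integral_poly_0 [simp]: "integral_poly 0"
  by (simp add: integral_poly_def)

lemma integral_poly_pCons [simp]:
  "integral_poly (pCons a P) \<longleftrightarrow> absv a \<le> 1 \<and> integral_poly P"
  unfolding integral_poly_def by (auto simp: coeff_pCons split: nat.splits)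

lemma integral_poly_1 [simp]: "integral_poly 1"
  by (simp add: one_pCons)

lemma integral_poly_add: "integral_poly P \<Longrightarrow> integral_poly Q \<Longrightarrow> integral_poly (P + Q)"
  unfolding integral_poly_def by (simp add: absv_add_le)

lemma integral_poly_diff: "integral_poly P \<Longrightarrow> integral_poly Q \<Longrightarrow> integral_poly (P - Q)"
  unfolding integral_poly_def by (simp add: absv_diff_le)

lemma integral_poly_mult: "integral_poly P \<Longrightarrow> integral_poly Q \<Longrightarrow> integral_poly (P * Q)"
  unfolding integral_poly_def coeff_mult by (intro allI absv_sum_le absv_mult_le_left) auto

lemma integral_poly_pcompose: "integral_poly P \<Longrightarrow> integral_poly Q \<Longrightarrow> integral_poly (pcompose P Q)"
  by (induction P) (simp_all add: pcompose_pCons integral_poly_add integral_poly_mult)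

lemma integral_poly_iterate: "integral_poly P \<Longrightarrow> integral_poly (iterate_poly P n)"
  by (induction n) (simp_all add: iterate_poly_def integral_poly_pcompose)

lemma absv_poly_le_1:
  assumes "integral_poly P" "absv x \<le> 1"
  shows "absv (poly P x) \<le> 1"
  using assms(1)
  by (induction P) (use assms(2) in \<open>auto intro: absv_add_le absv_mult_le_left\<close>)

text \<open>The Horner recursion accumulates no constant: on the closed unit ball the values of an
  integral polynomial are again integral.\<close>

lemma absv_poly_diff_le:
  assumes "integral_poly P" "absv x \<le> 1" "absv y \<le> 1"
  shows "absv (poly P x - poly P y) \<le> absv (x - y)"
  using assms(1)
proof (induction P)
  case (pCons a P)
  have *: "poly (pCons a P) x - poly (pCons a P) y = (x - y) * poly P x + y * (poly P x - poly P y)"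
    by (simp add: algebra_simps)
  show ?case
    unfolding * using pCons assms(2,3)
    by (intro absv_add_le absv_mult_le_right absv_mult_le_left) (simp_all add: absv_poly_le_1)
qed (simp add: absv_nonneg)

text \<open>The absolute value of the first nonzero coefficient of the expansion of \<open>P\<close> in powers of
  \<open>x - q\<close>.\<close>

definition leading_absv :: "'a \<Rightarrow> 'a poly \<Rightarrow> real" where
  "leading_absv q P = absv (poly (P div [:- q, 1:] ^ order q P) q)"

lemma leading_absv_eqI:
  assumes "P = [:- q, 1:] ^ m * Q" "poly Q q \<noteq> 0"
  shows "leading_absv q P = absv (poly Q q)"
proof -
  have "P \<noteq> 0" using assms by auto
  then have "order q P = m"
    using assms by (simp add: order_mult order_power_n_n order_0I)
  then show ?thesis using assms(1) by (simp add: leading_absv_def)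
qed

lemma leading_decomp:
  assumes "P \<noteq> 0"
  obtains Q where "P = [:- q, 1:] ^ order q P * Q" "poly Q q \<noteq> 0"
  using order_decomp[OF assms, of q] by (auto simp: poly_eq_0_iff_dvd)

text \<open>Lowest-order terms at \<open>q\<close> multiply: the orders add and the product of the
  cofactors is nonzero at \<open>q\<close>.\<close>

lemma leading_absv_mult: "leading_absv q (P * R) = leading_absv q P * leading_absv q R"
proof (cases "P = 0 \<or> R = 0")
  case True
  \<comment> \<open>The zero polynomial has \<open>leading_absv\<close> 0, since
    \<open>0 div _ = 0\<close>.\<close>
  then show ?thesis by (auto simp: leading_absv_def)
next
  case False
  obtain Q where Q: "P = [:- q, 1:] ^ order q P * Q" "poly Q q \<noteq> 0"
    using False leading_decomp by blast
  obtain S where S: "R = [:- q, 1:] ^ order q R * S" "poly S q \<noteq> 0"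
    using False leading_decomp by blast
  have "P * R = [:- q, 1:] ^ (order q P + order q R) * (Q * S)"
    by (subst Q(1), subst S(1)) (simp add: power_add mult_ac)
  from leading_absv_eqI[OF this] leading_absv_eqI[OF Q] leading_absv_eqI[OF S] Q(2) S(2)
  show ?thesis by (simp add: absv_mult)
qed

lemma leading_absv_eq: "poly P q \<noteq> 0 \<Longrightarrow> leading_absv q P = absv (poly P q)"
  using leading_absv_eqI[of P q 0 P] by simp

lemma leading_absv_pos: "P \<noteq> 0 \<Longrightarrow> 0 < leading_absv q P"
  using leading_decomp[of P q] leading_absv_eqI absv_pos_iff by metis

lemma leading_absv_nonneg: "0 \<le> leading_absv q P"
  by (simp add: leading_absv_def absv_nonneg)

text \<open>Divide out the zeros at \<open>q\<close> one by one: for integral \<open>q\<close>, synthetic division keeps the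
  coefficients integral.\<close>

lemma integral_poly_synthetic_div:
  assumes "integral_poly P" "absv q \<le> 1"
  shows "integral_poly (synthetic_div P q)"
  using assms(1) by (induction P) (simp_all add: absv_poly_le_1 assms(2))

lemma leading_absv_le_1:
  assumes "integral_poly P" "absv q \<le> 1"
  shows "leading_absv q P \<le> 1"
  using assms(1)
proof (induction "degree P" arbitrary: P rule: less_induct)
  case less
  show ?case
  proof (cases "poly P q = 0")
    case False
    then show ?thesis
      using less.prems assms(2) by (simp add: leading_absv_eq absv_poly_le_1)
  next
    case True
    show ?thesis
    proof (cases "P = 0")
      case True
      then show ?thesis by (simp add: leading_absv_def)
    next
      case False
      define S where "S = synthetic_div P q"
      have P: "P = [:- q, 1:] * S"
        using synthetic_div_correct'[of q P] True by (simp add: S_def)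
      have "degree P \<noteq> 0" 
        by (metis P S_def False mult_zero_right synthetic_div_eq_0_iff)
      then have "leading_absv q S \<le> 1"
        using less integral_poly_synthetic_div[OF less.prems assms(2)]
        by (simp add: S_def degree_synthetic_div)
      moreover have "leading_absv q [:- q, 1:] = 1"
        using leading_absv_eqI[of "[:- q, 1:]" q 1 1] by simp
      ultimately show ?thesis
        by (subst P, subst leading_absv_mult) simp
    qed
  qed
qed

text \<open>Split off linear factors. One vanishing at \<open>q\<close> has
  \<open>leading_absv\<close> 1, any other contributes the distance of its root from
  \<open>q\<close>. The fixed set \<open>S\<close> gives \<open>P\<close> and its quotient the same
  index set.\<close>

lemma leading_absv_eq_prod:
  assumes closed: "\<And>P :: 'a poly. 0 < degree P \<Longrightarrow> \<exists>x. poly P x = 0"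
    and "P \<noteq> 0" "finite S" "{x. poly P x = 0} \<subseteq> S"
  shows "leading_absv q P = absv (lead_coeff P) * (\<Prod>x\<in>S - {q}. absv (x - q) ^ order x P)"
  using assms(2,4)
proof (induction "degree P" arbitrary: P rule: less_induct)
  case less
  show ?case
  proof (cases "degree P = 0")
    case True
    then obtain c where c: "P = [:c:]" by (rule degree_eq_zeroE)
    with less.prems have "order x P = 0" for x
      by (intro order_0I) simp
    then show ?thesis
      using c less.prems by (simp add: leading_absv_eq)
  next
    case False
    then obtain r where r: "poly P r = 0" using closed by blast
    define Q where "Q = synthetic_div P r"
    have P: "P = [:- r, 1:] * Q"
      using synthetic_div_correct'[of r P] r by (simp add: Q_def)
    have "Q \<noteq> 0" using less.prems P by auto
    have "r \<in> S" using r less.prems by auto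
    have "{x. poly Q x = 0} \<subseteq> S" using less.prems P by auto
    then have IH: "leading_absv q Q
        = absv (lead_coeff Q) * (\<Prod>x\<in>S - {q}. absv (x - q) ^ order x Q)"
      using less.hyps[of Q] False \<open>Q \<noteq> 0\<close> by (simp add: Q_def degree_synthetic_div)
    have ord: "order x P = (if x = r then 1 else 0) + order x Q" for x
    proof -
      have "order x [:- r, 1:] = (if x = r then 1 else 0)"
        using order_power_n_n[of r 1] by (auto intro: order_0I)
      then show ?thesis
        using order_mult[of "[:- r, 1:]" Q x] less.prems P by auto
    qed
    have lin: "leading_absv q [:- r, 1:] = (\<Prod>x\<in>S - {q}. absv (x - q) ^ (if x = r then 1 else 0))"
    proof (cases "r = q")
      case True
      have "leading_absv q [:- r, 1:] = 1"
        using leading_absv_eqI[of "[:- q, 1:]" q 1 1] True by simp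
      moreover have "(\<Prod>x\<in>S - {q}. absv (x - q) ^ (if x = r then 1 else 0)) = 1"
        using True by (intro prod.neutral) auto
      ultimately show ?thesis by simp
    next
      case False
      have "(\<Prod>x\<in>S - {q}. absv (x - q) ^ (if x = r then 1 else 0))
          = (\<Prod>x\<in>S - {q}. if r = x then absv (x - q) else 1)"
        by (intro prod.cong) auto
      also have "\<dots> = absv (r - q)"
        using False \<open>r \<in> S\<close> \<open>finite S\<close> by (subst prod.delta') auto
      finally show ?thesis
        using False absv_diff_commute[of q r] by (simp add: leading_absv_eq)
    qed
    have "leading_absv q P = leading_absv q [:- r, 1:] * leading_absv q Q"
      by (subst P) (rule leading_absv_mult)
    also have "\<dots> = absv (lead_coeff Q) * (\<Prod>x\<in>S - {q}. absv (x - q) ^ order x P)"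
      unfolding lin IH ord power_add prod.distrib by (simp add: mult_ac)
    also have "lead_coeff Q = lead_coeff P"
      unfolding P lead_coeff_mult by simp
    finally show ?thesis .
  qed
qed

end

section \<open>Algebraic closedness of the p-adic complex numbers\<close>

context padic_complex_field
begin

section \<open>The p-adic absolute value of natural numbers\<close>

lemma absv_of_nat:
  assumes "0 < n"
  shows "absv (of_nat n) = 1 / real p ^ multiplicity p n"
proof -
  have "multiplicity (int p) (int n) = multiplicity p n"
    by (simp add: multiplicity_def flip: of_nat_power)
  moreover have "quotient_of (of_nat n) = (int n, 1)"
    using quotient_of_int[of "int n"] by simp
  ultimately have "padic_abs p (of_nat n) = real p powi - int (multiplicity p n)"
    using assms by (simp add: padic_abs_def)
  then show ?thesis
    using absv_of_rat[of "of_nat n"] by (simp add: power_int_minus divide_inverse)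
qed

lemma absv_prime: "absv (of_nat p) = 1 / real p"
  using absv_of_nat[of p] prime_p by (simp add: prime_gt_0_nat)

lemma absv_of_nat_not_dvd: "\<not> p dvd n \<Longrightarrow> absv (of_nat n) = 1"
  using absv_of_nat[of n] by (cases "n = 0") (simp_all add: not_dvd_imp_multiplicity_0)

lemma absv_of_nat_ge:
  assumes "0 < n"
  shows "1 / real n \<le> absv (of_nat n)"
proof -
  have "p ^ multiplicity p n \<le> n"
    using assms multiplicity_dvd[of p n] by (intro dvd_imp_le) auto
  then have "real p ^ multiplicity p n \<le> real n"
    by (metis of_nat_le_iff of_nat_power)
  then show ?thesis
    using assms prime_gt_0_nat[OF prime_p] by (simp add: absv_of_nat frac_le)
qed

section \<open>The field of algebraic elements over the closure of the rationals\<close>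

lemma rational_closure_diff:
  assumes "x \<in> rational_closure absv" "y \<in> rational_closure absv"
  shows "x - y \<in> rational_closure absv"
  unfolding rational_closure_def closure_of_iff
proof (intro allI impI)
  fix r :: real assume "0 < r"
  then obtain a b where ab: "a \<in> \<rat>" "b \<in> \<rat>" "absv (x - a) < r" "absv (y - b) < r"
    using assms unfolding rational_closure_def closure_of_iff by meson
  have "absv ((x - y) - (a - b)) < r"
    using absv_ultrametric[of "x - a" "- (y - b)"] ab(3,4) absv_minus[of "y - b"]
    by (simp add: algebra_simps del: minus_diff_eq)
  then show "\<exists>c\<in>\<rat>. absv ((x - y) - c) < r"
    using ab Rats_diff by blast
qed

lemma Rats_subset_rational_closure: "a \<in> \<rat> \<Longrightarrow> a \<in> rational_closure absv"
  unfolding rational_closure_def closure_of_iff by (metis absv_0 diff_self)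

abbreviation K :: "'a set" where
  "K \<equiv> algebraic_elements (rational_closure absv)"

text \<open>Substituting \<open>X - 1\<close> into \<open>a + X * g\<close> gives
  \<open>a + X * h - h\<close>, where \<open>h\<close> is the shifted \<open>g\<close>, so closure
  under differences suffices.\<close>

lemma rational_closure_coeff_shift:
  assumes "\<And>i. coeff g i \<in> rational_closure absv"
  shows "coeff (pcompose g [:- 1, 1:]) i \<in> rational_closure absv"
  using assms
proof (induction g arbitrary: i)
  case 0
  then show ?case by (simp add: Rats_subset_rational_closure)
next
  case (pCons a g)
  have a: "a \<in> rational_closure absv" and g: "coeff g i \<in> rational_closure absv" for i
    using pCons.prems[of 0] pCons.prems[of "Suc i"] by simp_all
  have diff: "coeff (pCons a h - h) i \<in> rational_closure absv"
    if "\<And>i. coeff h i \<in> rational_closure absv" for h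
    using a that by (simp add: coeff_pCons rational_closure_diff split: nat.split)
  have "pcompose (pCons a g) [:- 1, 1:]
      = pCons a (pcompose g [:- 1, 1:]) - pcompose g [:- 1, 1:]"
    by (simp add: pcompose_pCons algebra_simps)
  then show ?case
    using diff[OF pCons.IH[OF g]] by simp
qed

text \<open>If \<open>y\<close> is a root of \<open>g\<close>, then \<open>y + 1\<close> is a root
  of \<open>g(X - 1)\<close>. With multiplication and division this yields all sums in
  \<open>K_add\<close>.\<close>

lemma K_shift:
  assumes "y \<in> K"
  shows "y + 1 \<in> K"
proof -
  obtain g where g: "g \<noteq> 0" "\<And>i. coeff g i \<in> rational_closure absv" "poly g y = 0"
    using assms unfolding algebraic_elements_def by blast
  have "pcompose g [:- 1, 1:] \<noteq> 0"
    using g(1) by (simp add: pcompose_eq_0_iff)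
  moreover have "poly (pcompose g [:- 1, 1:]) (y + 1) = 0"
    by (simp add: poly_pcompose g(3))
  ultimately show ?thesis
    unfolding algebraic_elements_def using rational_closure_coeff_shift[OF g(2)] by blast
qed

lemma K_0: "0 \<in> K"
  unfolding algebraic_elements_def
  by (auto intro!: exI[of _ "[:0, 1:]"] Rats_subset_rational_closure simp: coeff_pCons split: nat.splits)

lemma K_1: "1 \<in> K"
  using K_shift[OF K_0] by simp

text \<open>Algebraic closedness applied to linear polynomials already yields closure under division.\<close>

lemma K_minus_divide:
  assumes "x \<in> K" "y \<in> K" "x \<noteq> 0"
  shows "- y / x \<in> K"
proof -
  have "\<forall>i. coeff [:y, x:] i \<in> K"
    using assms K_0 by (auto simp: coeff_pCons split: nat.splits)
  then obtain r where "r \<in> K" "poly [:y, x:] r = 0"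
    using closed assms(3) unfolding algebraically_closed_def
    by (metis degree_pCons_eq_if pCons_eq_0_iff zero_less_Suc)
  moreover from this(2) have "r = - y / x"
    using assms(3) by (simp add: field_simps add_eq_0_iff)
  ultimately show ?thesis by simp
qed

lemma K_minus: "y \<in> K \<Longrightarrow> - y \<in> K"
  using K_minus_divide[of 1 y] K_1 by simp

lemma K_divide: "x \<in> K \<Longrightarrow> y \<in> K \<Longrightarrow> y / x \<in> K"
  using K_minus_divide[of x "- y"] K_minus[of y] K_0 by (cases "x = 0") auto

lemma K_mult: "x \<in> K \<Longrightarrow> y \<in> K \<Longrightarrow> x * y \<in> K"
  using K_divide[of "1 / y" x] K_divide[of y 1] K_1 K_0 by (cases "y = 0") auto

lemma K_add:
  assumes "x \<in> K" "y \<in> K"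
  shows "x + y \<in> K"
proof (cases "x = 0")
  case False
  then have "x + y = x * (y / x + 1)"
    by (simp add: field_simps)
  then show ?thesis
    using assms by (simp add: K_mult K_shift K_divide)
qed (use assms in simp)

lemma K_poly: "(\<And>i. coeff P i \<in> K) \<Longrightarrow> x \<in> K \<Longrightarrow> poly P x \<in> K"
  unfolding poly_altdef
proof -
  assume *: "\<And>i. coeff P i \<in> K" "x \<in> K"
  have "x ^ n \<in> K" for n
    by (induction n) (simp_all add: K_1 K_mult *)
  then have "coeff P i * x ^ i \<in> K" for i
    using * by (simp add: K_mult)
  then have "(\<Sum>i\<in>I. coeff P i * x ^ i) \<in> K" for I
    by (induct I rule: infinite_finite_induct) (simp_all add: K_0 K_add)
  then show "(\<Sum>i\<le>degree P. coeff P i * x ^ i) \<in> K" by simp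
qed

lemma K_synthetic_div:
  assumes "\<And>i. coeff P i \<in> K" "x \<in> K"
  shows "coeff (synthetic_div P x) i \<in> K"
  using assms(1)
proof (induction P arbitrary: i)
  case 0
  then show ?case by simp
next
  case (pCons a P)
  have P: "coeff P i \<in> K" for i
    using pCons.prems[of "Suc i"] by simp
  show ?case
    using pCons.IH[OF P] K_poly[OF P assms(2)]
    by (auto simp: coeff_pCons split: nat.splits)
qed

text \<open>Over \<open>K\<close> the polynomial splits, so \<open>absv (poly P x)\<close> is the
  product of the distances from \<open>x\<close> to the roots; they cannot all exceed
  \<open>\<delta>\<close>. The induction removes one far root at a time.\<close>

lemma ex_near_root:
  assumes "lead_coeff P = 1" "\<And>i. coeff P i \<in> K" "0 < degree P"
    and "0 < \<delta>" "absv (poly P x) \<le> \<delta> ^ degree P"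
  shows "\<exists>r. poly P r = 0 \<and> absv (x - r) \<le> \<delta>"
  using assms(1,2,3,5)
proof (induction "degree P" arbitrary: P)
  case (Suc n)
  obtain r where r: "r \<in> K" "poly P r = 0"
    using closed Suc.prems unfolding algebraically_closed_def by metis
  define Q where "Q = synthetic_div P r"
  have P: "P = [:- r, 1:] * Q"
    using synthetic_div_correct'[of r P] r by (simp add: Q_def)
  have degQ: "degree Q = n"
    using Suc.hyps(2) by (simp add: Q_def degree_synthetic_div flip: Suc.hyps(2))
  have "lead_coeff P = lead_coeff Q"
    unfolding P lead_coeff_mult by simp
  then have lcQ: "lead_coeff Q = 1" using Suc.prems by simp
  show ?case
  proof (cases "absv (x - r) \<le> \<delta>")
    case True
    then show ?thesis using r by blast
  next
    case False
    have "absv (poly P x) = absv (x - r) * absv (poly Q x)"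
      by (simp add: P absv_mult left_diff_distrib [symmetric])
    then have *: "absv (x - r) * absv (poly Q x) \<le> \<delta> * \<delta> ^ n"
      using Suc.prems(4) by (simp flip: Suc.hyps(2))
    have "\<delta> * absv (poly Q x) \<le> absv (x - r) * absv (poly Q x)"
      using False by (intro mult_right_mono) (auto simp: absv_nonneg)
    also note *
    finally have "absv (poly Q x) \<le> \<delta> ^ degree Q"
      using \<open>0 < \<delta>\<close> degQ by simp
    \<comment> \<open>For \<open>n = 0\<close> the cofactor is 1 and the bound on
      \<open>poly P x\<close> would make \<open>r\<close> a near root.\<close>
    moreover have "n \<noteq> 0"
    proof
      assume "n = 0"
      then obtain c where "Q = [:c:]" using degQ by (auto elim: degree_eq_zeroE)
      then have "poly Q x = 1" using lcQ by simp
      then show False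
        using *[unfolded \<open>n = 0\<close>] False by simp
    qed
    moreover have "\<And>i. coeff Q i \<in> K"
      using K_synthetic_div Suc.prems(2) r(1) by (simp add: Q_def)
    ultimately obtain s where "poly Q s = 0" "absv (x - s) \<le> \<delta>"
      using Suc.hyps(1)[of Q] degQ lcQ \<open>n \<noteq> 0\<close> by auto
    then show ?thesis by (auto simp: P)
  qed
qed simp

text \<open>The lower coefficients are approximated by density of \<open>K\<close>, while the
  leading 1 is kept exactly, which preserves the degree.\<close>

lemma ex_monic_approx:
  assumes "lead_coeff P = 1" "0 < degree P" "0 < e"
  shows "\<exists>R. lead_coeff R = 1 \<and> degree R = degree P \<and> (\<forall>i. coeff R i \<in> K)
    \<and> (\<forall>i. absv (coeff (R - P) i) \<le> e)"
proof -
  have "\<exists>y\<in>K. absv (c - y) < e" for c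
    using dense \<open>0 < e\<close> closure_of_iff[of c K] by auto
  then obtain a where a: "\<And>c. a c \<in> K" "\<And>c. absv (c - a c) < e" by metis
  define S where "S = (\<Sum>i<degree P. monom (a (coeff P i)) i)"
  define R where "R = S + monom 1 (degree P)"
  have S: "coeff S i = (if i < degree P then a (coeff P i) else 0)" for i
    by (simp add: S_def coeff_sum)
  have R: "coeff R i = (if i < degree P then a (coeff P i) else if i = degree P then 1 else 0)" for i
    by (simp add: R_def S)
  have deg: "degree R = degree P"
    by (rule antisym[OF degree_le le_degree]) (simp_all add: R)
  have "coeff R i \<in> K" for i
    by (simp add: R a K_1 K_0)
  moreover have "absv (coeff (R - P) i) \<le> e" for i
    using a(2)[of "coeff P i"] assms(1,3) absv_diff_commute[of "coeff P i" "a (coeff P i)"]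
    by (cases i "degree P" rule: linorder_cases) (simp_all add: R coeff_eq_0)
  ultimately show ?thesis
    using deg by (intro exI[of _ R]) (simp add: R)
qed

text \<open>Near roots of \<open>P\<close> are near roots of a close polynomial over \<open>K\<close>, whose true roots are
  better near roots of \<open>P\<close>.\<close>

lemma ex_better_root:
  assumes "lead_coeff P = 1" "0 < degree P" "0 < \<delta>" "0 < \<eta>"
    and "absv (poly P x) \<le> \<delta> ^ degree P"
  shows "\<exists>y. absv (poly P y) \<le> \<eta> ^ degree P \<and> absv (x - y) \<le> \<delta>"
proof -
  \<comment> \<open>The ball of radius \<open>t\<close> contains \<open>x\<close> and everything
    within \<open>\<delta>\<close> of it. The tolerance \<open>m\<close> serves both the hypothesis
    at \<open>x\<close> and the conclusion at \<open>y\<close>, and \<open>e\<close> is the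
    coefficient error that keeps values on the ball within \<open>m\<close>.\<close>
  define t where "t = max 1 (max (absv x) \<delta>)"
  define m where "m = min (\<delta> ^ degree P) (\<eta> ^ degree P)"
  define e where "e = m / t ^ degree P"
  have "0 < t" "0 < m" "1 \<le> t" using assms by (simp_all add: t_def m_def)
  then have "0 < e" by (simp add: e_def)
  then obtain R where R: "lead_coeff R = 1" "degree R = degree P" "\<And>i. coeff R i \<in> K"
    "\<And>i. absv (coeff (R - P) i) \<le> e"
    using ex_monic_approx[OF assms(1,2)] by blast
  have close: "absv (poly R z - poly P z) \<le> m" if "absv z \<le> t" for z
  proof -
    have "absv (poly (R - P) z) \<le> e * t ^ degree (R - P)"
      using R(4) that \<open>1 \<le> t\<close> by (rule absv_poly_le)
    also have "\<dots> \<le> e * t ^ degree P"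
      using \<open>1 \<le> t\<close> \<open>0 < e\<close> R(2) degree_diff_le[of R "degree P" P]
      by (intro mult_left_mono power_increasing) auto
    also have "\<dots> = m" using \<open>0 < t\<close> by (simp add: e_def)
    finally show ?thesis by simp
  qed
  have "absv (poly R x) \<le> \<delta> ^ degree P"
    using absv_add_le[of "poly R x - poly P x" "\<delta> ^ degree P" "poly P x"] close[of x] assms(5)
    by (simp add: t_def m_def)
  then obtain y where y: "poly R y = 0" "absv (x - y) \<le> \<delta>"
    using ex_near_root[of R \<delta> x] R assms by auto
  have "absv y \<le> t"
    using absv_diff_le[of x t "x - y"] y(2) by (simp add: t_def)
  then have "absv (poly P y) \<le> \<eta> ^ degree P"
    using close[of y] y(1) by (simp add: m_def)
  then show ?thesis using y(2) by blast
qed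

text \<open>Iterating \<open>ex_better_root\<close> along a null sequence produces a Cauchy sequence
  of ever better near roots; by completeness and continuity its limit is a root.\<close>

lemma ex_root:
  assumes "0 < degree P"
  shows "\<exists>x :: 'a. poly P x = 0"
proof -
  define M where "M = smult (1 / lead_coeff P) P"
  have lc: "lead_coeff P \<noteq> 0" using assms by auto
  have M: "lead_coeff M = 1" "degree M = degree P"
    using lc by (simp_all add: M_def)
  \<comment> \<open>With \<open>1 \<le> b\<close> the value at 0 is at most
    \<open>b ^ degree M\<close>, so 0 can start the sequence.\<close>
  define b where "b = max 1 (absv (poly M 0))"
  have "0 < b" by (simp add: b_def)
  define \<delta> where "\<delta> n = b / 2 ^ n" for n
  have \<delta>_pos: "0 < \<delta> n" for n using \<open>0 < b\<close> by (simp add: \<delta>_def)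
  have \<delta>_mono: "\<delta> n \<le> \<delta> m" if "m \<le> n" for m n
    using \<open>0 < b\<close> that by (simp add: \<delta>_def frac_le)
  have \<delta>_lim: "\<delta> \<longlonglongrightarrow> 0"
    unfolding \<delta>_def by (rule LIMSEQ_divide_realpow_zero) simp
  have "\<exists>X. \<forall>n. absv (poly M (X n)) \<le> \<delta> n ^ degree M \<and> absv (X n - X (Suc n)) \<le> \<delta> n"
  proof (rule dependent_nat_choice)
    have "b \<le> b ^ degree M"
      using assms M by (intro self_le_power) (auto simp: b_def)
    then have "absv (poly M 0) \<le> \<delta> 0 ^ degree M"
      by (simp add: \<delta>_def b_def)
    then show "\<exists>x. absv (poly M x) \<le> \<delta> 0 ^ degree M" by blast
  next
    fix x n assume "absv (poly M x) \<le> \<delta> n ^ degree M"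
    then show "\<exists>y. absv (poly M y) \<le> \<delta> (Suc n) ^ degree M \<and> absv (x - y) \<le> \<delta> n"
      using ex_better_root[OF M(1) _ \<delta>_pos \<delta>_pos] assms M by simp
  qed
  then obtain X where X: "\<And>n. absv (poly M (X n)) \<le> \<delta> n ^ degree M"
    "\<And>n. absv (X n - X (Suc n)) \<le> \<delta> n" by blast
  \<comment> \<open>By the ultrametric inequality the largest single step bounds the whole
    tail.\<close>
  have tail: "absv (X N - X (N + k)) \<le> \<delta> N" for N k
  proof (induction k)
    case 0
    show ?case using \<delta>_pos[of N] by simp
  next
    case (Suc k)
    have "absv (X (N + k) - X (N + Suc k)) \<le> \<delta> N"
      using order_trans[OF X(2)[of "N + k"] \<delta>_mono[of N "N + k"]] by simp
    with Suc show ?case by (rule absv_diff_trans)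
  qed
  have "metr.MCauchy X"
    unfolding metr.MCauchy_def
  proof (intro conjI allI impI)
    fix e :: real assume "0 < e"
    then obtain N where N: "\<delta> N < e"
      using order_tendstoD(2)[OF \<delta>_lim] by (auto simp: eventually_sequentially)
    have "absv (X n - X n') < e" if "N \<le> n" "N \<le> n'" for n n'
    proof -
      have "absv (X n - X N) \<le> \<delta> N" "absv (X N - X n') \<le> \<delta> N"
        using tail[of N "n - N"] tail[of N "n' - N"] that absv_diff_commute[of "X n" "X N"] by simp_all
      then show ?thesis using N absv_diff_trans by fastforce
    qed
    then show "\<exists>N. \<forall>n n'. N \<le> n \<longrightarrow> N \<le> n' \<longrightarrow> absv (X n - X n') < e" by blast
  qed simp
  then obtain x where x: "limitin metr.mtopology X x sequentially"
    using complete unfolding metr.mcomplete_def by blast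
  have ev: "\<forall>\<^sub>F n in sequentially. absv (X n - x) < e" if "0 < e" for e
    using x that unfolding metr.limitin_metric by (auto elim: eventually_mono)
  obtain c where c: "0 \<le> c" "\<And>y. absv (x - y) \<le> 1 \<Longrightarrow> absv (poly M x - poly M y) \<le> c * absv (x - y)"
    using poly_absv_continuous[of x M] by blast
  have "absv (poly M x) \<le> e" if "0 < e" for e
  proof -
    have "(\<lambda>n. \<delta> n ^ degree M) \<longlonglongrightarrow> 0"
      using \<delta>_lim assms M by (intro tendsto_null_power) auto
    then have "\<forall>\<^sub>F n in sequentially. \<delta> n ^ degree M < e"
      using that by (rule order_tendstoD(2))
    \<comment> \<open>The denominator \<open>c + 1\<close> covers \<open>c = 0\<close>; the minimum
      with 1 stays where the Lipschitz bound holds.\<close>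
    moreover have "0 < min 1 (e / (c + 1))" using that c by simp
    note ev[OF this]
    ultimately have "\<forall>\<^sub>F n in sequentially. \<delta> n ^ degree M < e \<and> absv (X n - x) < min 1 (e / (c + 1))"
      by (rule eventually_conj)
    then obtain n where n: "\<delta> n ^ degree M < e" "absv (X n - x) < min 1 (e / (c + 1))"
      by (auto simp: eventually_sequentially)
    have "absv (poly M x - poly M (X n)) \<le> c * absv (x - X n)"
      using n(2) c(2)[of "X n"] absv_diff_commute[of x "X n"] by simp
    also have "\<dots> \<le> c * (e / (c + 1))"
      using n(2) c(1) absv_diff_commute[of x "X n"] by (intro mult_left_mono) auto
    also have "\<dots> \<le> e"
      using c(1) that by (simp add: field_simps)
    finally have "absv (poly M x - poly M (X n)) \<le> e" .
    moreover have "absv (poly M (X n)) \<le> e" using X(1)[of n] n(1) by simp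
    ultimately have "absv ((poly M x - poly M (X n)) + poly M (X n)) \<le> e" by (rule absv_add_le)
    then show ?thesis by simp
  qed
  then have "absv (poly M x) \<le> 0"
    by (metis field_le_epsilon add_0)
  then have "poly M x = 0"
    using absv_pos_iff[of "poly M x"] by linarith
  then show ?thesis
    using lc by (auto simp: M_def)
qed

end

section \<open>Iterates and almost fixed points\<close>

lemma iterate_poly_0 [simp]: "iterate_poly f 0 = [:0, 1:]"
  by (simp add: iterate_poly_def)

lemma iterate_poly_Suc: "iterate_poly f (Suc n) = pcompose f (iterate_poly f n)"
  by (simp add: iterate_poly_def)

text \<open>Comparing polynomial functions suffices, as a field of characteristic 0 is
  infinite.\<close>

lemma iterate_poly_mult:
  fixes f :: "'a::field_char_0 poly"
  shows "iterate_poly (iterate_poly f m) n = iterate_poly f (m * n)"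
proof -
  have "poly (iterate_poly f m) = poly f ^^ m"
    by (simp add: fun_eq_iff poly_iterate_poly)
  then have "poly (iterate_poly (iterate_poly f m) n) x = poly (iterate_poly f (m * n)) x" for x
    by (simp only: poly_iterate_poly funpow_mult)
  then show ?thesis
    by (simp add: fun_eq_iff flip: poly_eq_poly_eq_iff)
qed

lemma degree_iterate_poly:
  fixes f :: "'a::field poly"
  shows "degree (iterate_poly f n) = degree f ^ n"
  by (induction n) (simp_all add: iterate_poly_Suc degree_pcompose)

text \<open>The iterate has degree greater than 1, so it cannot equal \<open>X\<close>; for
  \<open>n = 0\<close> the difference is 0.\<close>

lemma iterate_poly_minus_X_neq_0:
  fixes f :: "'a::field poly"
  assumes "2 \<le> degree f" "0 < n"
  shows "iterate_poly f n - [:0, 1:] \<noteq> 0"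
proof -
  have "degree [:0, 1 :: 'a:] < degree (iterate_poly f n)"
    using assms self_le_power[of "degree f" n] by (simp add: degree_iterate_poly)
  then show ?thesis by auto
qed

context nonarch_absolute_value
begin

lemma absv_lead_coeff_iterate_poly:
  assumes "absv (lead_coeff f) = 1" "0 < degree f"
  shows "absv (lead_coeff (iterate_poly f n)) = 1"
proof (induction n)
  case (Suc n)
  have "0 < degree (iterate_poly f n)"
    using assms(2) by (simp add: degree_iterate_poly)
  then have "lead_coeff (iterate_poly f (Suc n)) = lead_coeff f * lead_coeff (iterate_poly f n) ^ degree f"
    unfolding iterate_poly_Suc by (rule lead_coeff_comp)
  then show ?case
    using Suc assms(1) by (simp add: absv_mult absv_power)
qed simp

text \<open>\<open>C\<close> is the divided difference of \<open>P\<close> at \<open>A\<close> and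
  \<open>B\<close>. As both take values close to \<open>q\<close> at \<open>q\<close>, it is there
  close to the derivative.\<close>

lemma pcompose_diff_factor:
  assumes "integral_poly P" "integral_poly A" "integral_poly B" "absv q \<le> 1"
    and "absv (poly A q - q) \<le> \<epsilon>" "absv (poly B q - q) \<le> \<epsilon>"
  shows "\<exists>C. integral_poly C \<and> pcompose P A - pcompose P B = (A - B) * C
    \<and> absv (poly C q - poly (pderiv P) q) \<le> \<epsilon>"
  using assms(1)
proof (induction P)
  case 0
  show ?case
    using order_trans[OF absv_nonneg assms(5)] by (intro exI[of _ 0]) simp
next
  case (pCons a P)
  then obtain C where C: "integral_poly C" "pcompose P A - pcompose P B = (A - B) * C"
    "absv (poly C q - poly (pderiv P) q) \<le> \<epsilon>" by auto
  have P: "integral_poly P" using pCons.prems by simp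
  have "pcompose (pCons a P) A - pcompose (pCons a P) B
      = (A - B) * pcompose P A + B * (pcompose P A - pcompose P B)"
    by (simp add: pcompose_pCons algebra_simps)
  also have "\<dots> = (A - B) * (pcompose P A + B * C)"
    unfolding C(2) by (simp add: algebra_simps)
  finally have "pcompose (pCons a P) A - pcompose (pCons a P) B = (A - B) * (pcompose P A + B * C)" .
  moreover have "integral_poly (pcompose P A + B * C)"
    using P assms C(1) by (simp add: integral_poly_add integral_poly_mult integral_poly_pcompose)
  moreover have "absv (poly (pcompose P A + B * C) q - poly (pderiv (pCons a P)) q) \<le> \<epsilon>"
  proof -
    \<comment> \<open>The recursion for the divided difference is matched with the product rule for
      the derivative of \<open>a + X * P\<close>.\<close>
    have "poly (pcompose P A + B * C) q - poly (pderiv (pCons a P)) q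
        = (poly P (poly A q) - poly P q) + ((poly B q - q) * poly C q
          + q * (poly C q - poly (pderiv P) q))"
      by (simp add: poly_pcompose pderiv_pCons algebra_simps)
    moreover have "absv (poly P (poly A q) - poly P q) \<le> \<epsilon>"
      using absv_poly_diff_le[OF P, of "poly A q" q] absv_poly_le_1[OF assms(2,4)] assms(4,5)
      by simp
    moreover have "absv ((poly B q - q) * poly C q) \<le> \<epsilon>"
      using assms(6) absv_poly_le_1[OF C(1) assms(4)] by (rule absv_mult_le_right)
    moreover have "absv (q * (poly C q - poly (pderiv P) q)) \<le> \<epsilon>"
      using assms(4) C(3) by (rule absv_mult_le_left)
    ultimately show ?thesis by (simp add: absv_add_le)
  qed
  ultimately show ?case by blast
qed

lemma integral_poly_pderiv: "integral_poly P \<Longrightarrow> integral_poly (pderiv P)"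
  by (induction P) (simp_all add: pderiv_pCons integral_poly_add)

text \<open>\<open>P\<close> does not increase distances on the unit ball, so each step of the orbit
  stays as close to \<open>q\<close> as the first one.\<close>

lemma absv_iterate_diff_le:
  assumes "integral_poly P" "absv q \<le> 1" "absv (poly P q - q) \<le> \<epsilon>"
  shows "absv (poly (iterate_poly P n) q - q) \<le> \<epsilon>"
proof (induction n)
  case 0
  show ?case using order_trans[OF absv_nonneg assms(3)] by simp
next
  case (Suc n)
  define x where "x = poly (iterate_poly P n) q"
  have "absv x \<le> 1"
    unfolding x_def using assms by (simp add: absv_poly_le_1 integral_poly_iterate)
  then have "absv (poly P x - poly P q) \<le> \<epsilon>"
    using absv_poly_diff_le[OF assms(1), of x q] assms(2) Suc by (simp add: x_def)
  then show ?case
    using assms(3) by (simp add: iterate_poly_Suc poly_pcompose x_def absv_diff_trans)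
qed

text \<open>The difference \<open>P\<^sup>i\<^sup>+\<^sup>1 - P\<^sup>i\<close> is \<open>P - X\<close> times \<open>i\<close> difference quotients
  of \<open>P\<close> along the orbit of \<open>q\<close>, each of which is \<open>\<epsilon>\<close>-close to the multiplier.\<close>

lemma iterate_diff_factor:
  assumes "integral_poly P" "absv q \<le> 1" "absv (poly P q - q) \<le> \<epsilon>"
  obtains Q where "integral_poly Q" "iterate_poly P n - [:0, 1:] = (P - [:0, 1:]) * Q"
    "absv (poly Q q - (\<Sum>i<n. poly (pderiv P) q ^ i)) \<le> \<epsilon>"
proof -
  define \<mu> where "\<mu> = poly (pderiv P) q"
  have eps: "0 \<le> \<epsilon>"
    using order_trans[OF absv_nonneg assms(3)] .
  have \<mu>: "absv \<mu> \<le> 1"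
    unfolding \<mu>_def using assms(1,2) by (simp add: absv_poly_le_1 integral_poly_pderiv)
  have step: "\<exists>E. integral_poly E \<and> iterate_poly P (Suc n) - iterate_poly P n = (P - [:0, 1:]) * E
    \<and> absv (poly E q - \<mu> ^ n) \<le> \<epsilon>" for n
  proof (induction n)
    case 0
    show ?case
      using eps by (intro exI[of _ 1]) (simp add: iterate_poly_Suc)
  next
    case (Suc n)
    then obtain E where E: "integral_poly E"
      "iterate_poly P (Suc n) - iterate_poly P n = (P - [:0, 1:]) * E"
      "absv (poly E q - \<mu> ^ n) \<le> \<epsilon>" by blast
    obtain C where C: "integral_poly C"
      "pcompose P (iterate_poly P (Suc n)) - pcompose P (iterate_poly P n)
        = (iterate_poly P (Suc n) - iterate_poly P n) * C"
      "absv (poly C q - \<mu>) \<le> \<epsilon>"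
      using pcompose_diff_factor[OF assms(1) integral_poly_iterate[OF assms(1)]
          integral_poly_iterate[OF assms(1)] assms(2) absv_iterate_diff_le[OF assms]
          absv_iterate_diff_le[OF assms]] unfolding \<mu>_def by blast
    have "iterate_poly P (Suc (Suc n)) - iterate_poly P (Suc n) = (P - [:0, 1:]) * (E * C)"
      using C(2) E(2) by (simp add: iterate_poly_Suc mult.assoc)
    moreover have "absv (poly (E * C) q - \<mu> ^ Suc n) \<le> \<epsilon>"
    proof -
      have "poly (E * C) q - \<mu> ^ Suc n
          = (poly E q - \<mu> ^ n) * poly C q + \<mu> ^ n * (poly C q - \<mu>)"
        by (simp add: algebra_simps)
      then show ?thesis
        using E C \<mu> assms(2)
        by (simp add: absv_add_le absv_mult_le_right absv_poly_le_1 absv_mult_le_left absv_power_le_1)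
    qed
    ultimately show ?case
      using integral_poly_mult[OF E(1) C(1)] by blast
  qed
  \<comment> \<open>Telescoping: summing the factors \<open>E\<close> gives a quotient close to the
    geometric sum.\<close>
  have "\<exists>Q. integral_poly Q \<and> iterate_poly P n - [:0, 1:] = (P - [:0, 1:]) * Q
    \<and> absv (poly Q q - (\<Sum>i<n. \<mu> ^ i)) \<le> \<epsilon>"
  proof (induction n)
    case 0
    show ?case using eps by (intro exI[of _ 0]) simp
  next
    case (Suc n)
    then obtain Q where Q: "integral_poly Q" "iterate_poly P n - [:0, 1:] = (P - [:0, 1:]) * Q"
      "absv (poly Q q - (\<Sum>i<n. \<mu> ^ i)) \<le> \<epsilon>" by blast
    obtain E where E: "integral_poly E"
      "iterate_poly P (Suc n) - iterate_poly P n = (P - [:0, 1:]) * E"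
      "absv (poly E q - \<mu> ^ n) \<le> \<epsilon>" using step by blast
    have "iterate_poly P (Suc n) - [:0, 1:]
        = (iterate_poly P (Suc n) - iterate_poly P n) + (iterate_poly P n - [:0, 1:])"
      by simp
    then have "iterate_poly P (Suc n) - [:0, 1:] = (P - [:0, 1:]) * (E + Q)"
      by (simp only: E(2) Q(2) distrib_left)
    moreover have "absv (poly (E + Q) q - (\<Sum>i<Suc n. \<mu> ^ i)) \<le> \<epsilon>"
      using absv_add_le[OF E(3) Q(3)] by (simp add: algebra_simps)
    ultimately show ?case
      using integral_poly_add[OF E(1) Q(1)] by blast
  qed
  then show ?thesis using that unfolding \<mu>_def by blast
qed

text \<open>Differentiate the factorization of \<open>iterate_poly P n - X\<close> at
  \<open>q\<close>: one term is close to \<open>\<mu> ^ n - 1\<close> through the geometric sum, the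
  other contains the small factor \<open>P(q) - q\<close>.\<close>

lemma absv_pderiv_iterate_diff_le:
  assumes "integral_poly P" "absv q \<le> 1" "absv (poly P q - q) \<le> \<epsilon>"
  shows "absv (poly (pderiv (iterate_poly P n)) q - poly (pderiv P) q ^ n) \<le> \<epsilon>"
proof -
  define \<mu> where "\<mu> = poly (pderiv P) q"
  obtain Q where Q: "integral_poly Q" "iterate_poly P n - [:0, 1:] = (P - [:0, 1:]) * Q"
    "absv (poly Q q - (\<Sum>i<n. \<mu> ^ i)) \<le> \<epsilon>"
    using iterate_diff_factor[OF assms] unfolding \<mu>_def by metis
  have "poly (pderiv (iterate_poly P n - [:0, 1:])) q
      = (\<mu> - 1) * poly Q q + (poly P q - q) * poly (pderiv Q) q"
    unfolding Q(2) by (simp add: pderiv_mult pderiv_diff pderiv_pCons \<mu>_def algebra_simps)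
  then have *: "poly (pderiv (iterate_poly P n)) q - 1
      = (\<mu> - 1) * poly Q q + (poly P q - q) * poly (pderiv Q) q"
    by (simp add: pderiv_diff pderiv_pCons)
  have "poly (pderiv (iterate_poly P n)) q - \<mu> ^ n
      = (poly (pderiv (iterate_poly P n)) q - 1) - (\<mu> ^ n - 1)"
    by simp
  also have "\<dots> = (\<mu> - 1) * (poly Q q - (\<Sum>i<n. \<mu> ^ i)) + (poly P q - q) * poly (pderiv Q) q"
    unfolding * power_diff_1_eq by (simp add: right_diff_distrib)
  finally have "poly (pderiv (iterate_poly P n)) q - \<mu> ^ n
      = (\<mu> - 1) * (poly Q q - (\<Sum>i<n. \<mu> ^ i)) + (poly P q - q) * poly (pderiv Q) q" .
  moreover have "absv (\<mu> - 1) \<le> 1"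
    unfolding \<mu>_def using assms by (simp add: absv_diff_le absv_poly_le_1 integral_poly_pderiv)
  ultimately show ?thesis
    using Q(3) assms(2,3) absv_poly_le_1[OF integral_poly_pderiv[OF Q(1)]]
    by (simp add: absv_add_le absv_mult_le_left absv_mult_le_right \<mu>_def)
qed

lemma leading_absv_iterate_le:
  assumes "integral_poly P" "absv q \<le> 1"
  shows "leading_absv q (iterate_poly P n - [:0, 1:]) \<le> leading_absv q (P - [:0, 1:])"
proof -
  \<comment> \<open>The trivial choice \<open>\<epsilon> = 1\<close> already gives the integral
    quotient.\<close>
  have "absv (poly P q - q) \<le> 1"
    using assms by (simp add: absv_diff_le absv_poly_le_1)
  then obtain Q where "integral_poly Q" "iterate_poly P n - [:0, 1:] = (P - [:0, 1:]) * Q"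
    using iterate_diff_factor assms by metis
  then show ?thesis
    using leading_absv_le_1[of Q q] assms(2) leading_absv_nonneg[of q "P - [:0, 1:]"]
    by (simp add: leading_absv_mult mult_left_le)
qed

end

context padic_complex_field
begin

text \<open>The previous estimate settles the case \<open>\<epsilon> < \<bar>n\<bar>\<close>, in particular \<open>n = p\<close> and \<open>n\<close> prime
  to \<open>p\<close>. As the hypotheses pass from \<open>P\<close> to its \<open>p\<close>-th iterate, the powers of \<open>p\<close> in \<open>n\<close>
  can be split off one at a time.\<close>

lemma leading_absv_iterate_eq:
  assumes "integral_poly P" "absv q \<le> 1"
    and "absv (poly P q - q) \<le> 1 / real p ^ 2" "absv (poly (pderiv P) q - 1) \<le> 1 / real p ^ 2"
    and "0 < n"
  shows "leading_absv q (iterate_poly P n - [:0, 1:])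
    = absv (of_nat n) * leading_absv q (P - [:0, 1:])"
  using assms(1,3,4,5)
proof (induction n arbitrary: P rule: less_induct)
  case (less n)
  have p: "2 \<le> p" using prime_p by (rule prime_ge_2_nat)
  then have eps: "1 / real p ^ 2 < 1 / real p" "1 / real p < 1"
    by (simp_all add: field_simps power2_eq_square)
  \<comment> \<open>All \<open>\<mu> ^ i\<close> are close to 1, so the quotient at \<open>q\<close>
    is close to \<open>m\<close>; when \<open>absv m\<close> exceeds the error, the two absolute
    values agree.\<close>
  have small: "leading_absv q (iterate_poly P m - [:0, 1:])
      = absv (of_nat m) * leading_absv q (P - [:0, 1:])"
    if m: "1 / real p ^ 2 < absv (of_nat m)" for m
  proof -
    obtain Q where Q: "iterate_poly P m - [:0, 1:] = (P - [:0, 1:]) * Q"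
      "absv (poly Q q - (\<Sum>i<m. poly (pderiv P) q ^ i)) \<le> 1 / real p ^ 2"
      using iterate_diff_factor less.prems(1,2) assms(2) by metis
    have "absv (poly (pderiv P) q) \<le> 1"
      using absv_add_le[of "poly (pderiv P) q - 1" 1 1] less.prems(3) eps by simp
    then have "absv (poly (pderiv P) q ^ i - 1 ^ i) \<le> 1 / real p ^ 2" for i
      using less.prems(3) by (intro absv_power_diff_le) simp_all
    then have "absv (\<Sum>i<m. poly (pderiv P) q ^ i - 1) \<le> 1 / real p ^ 2"
      by (intro absv_sum_le) simp_all
    then have "absv ((\<Sum>i<m. poly (pderiv P) q ^ i) - of_nat m) \<le> 1 / real p ^ 2"
      by (simp add: sum_subtractf)
    with Q(2) have "absv (poly Q q - of_nat m) \<le> 1 / real p ^ 2"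
      by (rule absv_diff_trans)
    then have Qq: "absv (poly Q q) = absv (of_nat m)"
      using m by (intro absv_eq_of_close) simp
    moreover have "0 \<le> 1 / real p ^ 2" by simp
    ultimately have "poly Q q \<noteq> 0" using m by auto
    then show ?thesis
      unfolding Q(1) leading_absv_mult by (simp add: leading_absv_eq Qq)
  qed
  show ?case
  proof (cases "p dvd n")
    case False
    then show ?thesis
      using small[of n] eps by (simp add: absv_of_nat_not_dvd)
  next
    case True
    then obtain k where k: "n = p * k" by blast
    define R where "R = iterate_poly P p"
    have "k < n" "0 < k" using k p less.prems(4) by auto
    have "absv (poly (pderiv P) q) \<le> 1"
      using absv_add_le[of "poly (pderiv P) q - 1" 1 1] less.prems(3) eps by simp
    then have "absv (poly (pderiv P) q ^ p - 1 ^ p) \<le> 1 / real p ^ 2"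
      using less.prems(3) by (intro absv_power_diff_le) simp_all
    then have "absv (poly (pderiv R) q - 1) \<le> 1 / real p ^ 2"
      using absv_pderiv_iterate_diff_le[OF less.prems(1) assms(2) less.prems(2), of p]
        absv_diff_trans unfolding R_def power_one by blast
    moreover have "integral_poly R" "absv (poly R q - q) \<le> 1 / real p ^ 2"
      unfolding R_def using less.prems assms(2) by (simp_all add: integral_poly_iterate absv_iterate_diff_le)
    ultimately have "leading_absv q (iterate_poly R k - [:0, 1:])
        = absv (of_nat k) * leading_absv q (R - [:0, 1:])"
      using less.IH[OF \<open>k < n\<close>] \<open>0 < k\<close> by blast
    moreover have "leading_absv q (R - [:0, 1:]) = absv (of_nat p) * leading_absv q (P - [:0, 1:])"
      unfolding R_def using small[of p] eps by (simp add: absv_prime)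
    moreover have "iterate_poly R k = iterate_poly P n"
      by (simp add: k R_def iterate_poly_mult)
    moreover have "absv (of_nat n) = absv (of_nat p) * absv (of_nat k)"
      by (simp add: k absv_mult)
    ultimately show ?thesis
      by (simp only: mult_ac)
  qed
qed

text \<open>The logarithm of such a lower bound decreases only like \<open>- ln n\<close>, which is
  negligible after division by \<open>degree f ^ n\<close>.\<close>

lemma leading_absv_iterate_ge:
  assumes "integral_poly f" "absv q \<le> 1" "2 \<le> degree f"
  shows "\<exists>c>0. \<forall>n>0. c / real n \<le> leading_absv q (iterate_poly f n - [:0, 1:])"
proof -
  define \<epsilon> where "\<epsilon> = 1 / real p ^ 2"
  have "0 < \<epsilon>" using prime_gt_0_nat[OF prime_p] by (simp add: \<epsilon>_def)
  have pos: "0 < leading_absv q (iterate_poly f n - [:0, 1:])" if "0 < n" for n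
    using assms(3) that by (intro leading_absv_pos iterate_poly_minus_X_neq_0)
  \<comment> \<open>It suffices to bound the iterates of one fixed \<open>iterate_poly f M\<close>:
    these are also the \<open>M\<close>-th iterates of \<open>iterate_poly f n\<close>, and
    iterating cannot increase \<open>leading_absv\<close>.\<close>
  have ret: ?thesis if "0 < M" "0 < e"
    and M: "\<And>n. 0 < n \<Longrightarrow> e / real n * leading_absv q (iterate_poly f M - [:0, 1:])
      \<le> leading_absv q (iterate_poly (iterate_poly f M) n - [:0, 1:])" for M e
  proof (intro exI[of _ "e * leading_absv q (iterate_poly f M - [:0, 1:])"] conjI allI impI)
    show "0 < e * leading_absv q (iterate_poly f M - [:0, 1:])"
      using that(1,2) pos by simp
    fix n :: nat assume "0 < n"
    have "e * leading_absv q (iterate_poly f M - [:0, 1:]) / real n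
        \<le> leading_absv q (iterate_poly (iterate_poly f M) n - [:0, 1:])"
      using M[OF \<open>0 < n\<close>] by simp
    also have "iterate_poly (iterate_poly f M) n = iterate_poly (iterate_poly f n) M"
      by (simp add: iterate_poly_mult mult.commute)
    also have "leading_absv q (iterate_poly (iterate_poly f n) M - [:0, 1:])
        \<le> leading_absv q (iterate_poly f n - [:0, 1:])"
      by (rule leading_absv_iterate_le[OF integral_poly_iterate[OF assms(1)] assms(2)])
    finally show "e * leading_absv q (iterate_poly f M - [:0, 1:]) / real n
        \<le> leading_absv q (iterate_poly f n - [:0, 1:])" .
  qed
  consider (far) "\<And>n. 0 < n \<Longrightarrow> \<epsilon> < absv (poly (iterate_poly f n) q - q)"
    | (near) m where "0 < m" "absv (poly (iterate_poly f m) q - q) \<le> \<epsilon>"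
    by (meson not_le)
  then show ?thesis
  proof cases
    case far
    have "\<epsilon> / real n \<le> leading_absv q (iterate_poly f n - [:0, 1:])" if "0 < n" for n
    proof -
      have "leading_absv q (iterate_poly f n - [:0, 1:]) = absv (poly (iterate_poly f n) q - q)"
        using far[OF that] \<open>0 < \<epsilon>\<close> by (subst leading_absv_eq) auto
      moreover have "\<epsilon> / real n \<le> \<epsilon>"
        using that \<open>0 < \<epsilon>\<close> by (simp add: field_simps)
      ultimately show ?thesis using far[OF that] by simp
    qed
    then show ?thesis using \<open>0 < \<epsilon>\<close> by blast
  next
    case near
    define g where "g = iterate_poly f m"
    define \<mu> where "\<mu> = poly (pderiv g) q"
    have g: "integral_poly g" "absv (poly g q - q) \<le> \<epsilon>"
      using assms(1) near by (simp_all add: g_def integral_poly_iterate)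
    show ?thesis
    proof (cases "\<exists>j>0. absv (\<mu> ^ j - 1) \<le> \<epsilon>")
      case True
      then obtain j where j: "0 < j" "absv (\<mu> ^ j - 1) \<le> \<epsilon>" by blast
      \<comment> \<open>Passing to the \<open>j\<close>-th iterate of \<open>g\<close> brings the
        multiplier within \<open>\<epsilon>\<close> of 1.\<close>
      define P where "P = iterate_poly f (m * j)"
      have P: "P = iterate_poly g j" by (simp add: P_def g_def iterate_poly_mult)
      have "integral_poly P" "absv (poly P q - q) \<le> \<epsilon>"
        unfolding P using g assms(2) by (simp_all add: integral_poly_iterate absv_iterate_diff_le)
      moreover have "absv (poly (pderiv P) q - 1) \<le> \<epsilon>"
        unfolding P using absv_pderiv_iterate_diff_le[OF g(1) assms(2) g(2)] j(2)
          absv_diff_trans unfolding \<mu>_def by blast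
      ultimately have eq: "leading_absv q (iterate_poly P n - [:0, 1:])
          = absv (of_nat n) * leading_absv q (P - [:0, 1:])" if "0 < n" for n
        using that assms(2) by (intro leading_absv_iterate_eq) (simp_all add: \<epsilon>_def)
      have "1 / real n * leading_absv q (P - [:0, 1:]) \<le> leading_absv q (iterate_poly P n - [:0, 1:])"
        if "0 < n" for n
        unfolding eq[OF that]
        by (intro mult_right_mono absv_of_nat_ge that leading_absv_nonneg)
      then show ?thesis
        using near j by (intro ret[of "m * j" 1]) (simp_all add: P_def)
    next
      case False
      have "\<epsilon> / real n * leading_absv q (g - [:0, 1:])
          \<le> leading_absv q (iterate_poly g n - [:0, 1:])" if "0 < n" for n
      proof -
        obtain Q where Q: "iterate_poly g n - [:0, 1:] = (g - [:0, 1:]) * Q"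
          "absv (poly Q q - (\<Sum>i<n. \<mu> ^ i)) \<le> \<epsilon>"
          using iterate_diff_factor[OF g(1) assms(2) g(2)] unfolding \<mu>_def by metis
        have "absv \<mu> \<le> 1"
          unfolding \<mu>_def using g(1) assms(2) by (simp add: absv_poly_le_1 integral_poly_pderiv)
        \<comment> \<open>The factor \<open>\<mu> - 1\<close> is integral, so the lower bound for
          \<open>\<mu> ^ n - 1\<close> passes to the geometric sum and then to \<open>Q\<close> at
          \<open>q\<close>.\<close>
        have "\<epsilon> < absv (\<mu> ^ n - 1)" using False that by (meson not_le)
        also have "\<dots> = absv ((\<mu> - 1) * (\<Sum>i<n. \<mu> ^ i))"
          by (simp only: power_diff_1_eq)
        also have "\<dots> \<le> absv (\<Sum>i<n. \<mu> ^ i)"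
          using \<open>absv \<mu> \<le> 1\<close> by (intro absv_mult_le_left absv_diff_le) simp_all
        finally have *: "\<epsilon> < absv (\<Sum>i<n. \<mu> ^ i)" .
        then have Qq: "absv (poly Q q) = absv (\<Sum>i<n. \<mu> ^ i)"
          using Q(2) by (intro absv_eq_of_close) simp
        then have "poly Q q \<noteq> 0" using * \<open>0 < \<epsilon>\<close> by auto
        then have "\<epsilon> < leading_absv q Q" using * Qq by (simp add: leading_absv_eq)
        moreover have "\<epsilon> / real n \<le> \<epsilon>"
          using that \<open>0 < \<epsilon>\<close> by (simp add: field_simps)
        ultimately have "\<epsilon> / real n \<le> leading_absv q Q" by simp
        then show ?thesis
          unfolding Q(1) leading_absv_mult using leading_absv_nonneg[of q "g - [:0, 1:]"]
          by (metis mult.commute mult_right_mono)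
      qed
      then show ?thesis
        using near \<open>0 < \<epsilon>\<close> by (intro ret[of m \<epsilon>]) (simp_all add: g_def)
    qed
  qed
qed

end

section \<open>Convergence\<close>

context padic_complex_field
begin

text \<open>The logarithm of the root product for \<open>leading_absv\<close>, in which the unit
  leading coefficient disappears.\<close>

lemma periodic_sum_eq:
  assumes "absv (lead_coeff f) = 1" "2 \<le> degree f" "0 < n"
  shows "(\<Sum>\<xi> | \<xi> \<noteq> q \<and> (poly f ^^ n) \<xi> = \<xi>.
      real (periodic_multiplicity f n \<xi>) * ln (absv (\<xi> - q)))
    = ln (leading_absv q (iterate_poly f n - [:0, 1:]))"
proof -
  define P where "P = iterate_poly f n - [:0, 1:]"
  define S where "S = {x. poly P x = 0}"
  have "P \<noteq> 0" unfolding P_def using assms by (intro iterate_poly_minus_X_neq_0)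
  then have "finite S" unfolding S_def by (rule poly_roots_finite)
  have S: "S - {q} = {\<xi>. \<xi> \<noteq> q \<and> (poly f ^^ n) \<xi> = \<xi>}"
    by (auto simp: S_def P_def poly_iterate_poly)
  have "degree [:0, 1 :: 'a:] < degree (iterate_poly f n)"
    using assms self_le_power[of "degree f" n] by (simp add: degree_iterate_poly)
  then have "lead_coeff P = lead_coeff (iterate_poly f n)"
    unfolding P_def uminus_add_conv_diff [symmetric] by (intro lead_coeff_add_le) simp
  then have "absv (lead_coeff P) = 1"
    using assms by (simp add: absv_lead_coeff_iterate_poly)
  then have "leading_absv q P = (\<Prod>x\<in>S - {q}. absv (x - q) ^ order x P)"
    using leading_absv_eq_prod[OF ex_root \<open>P \<noteq> 0\<close> \<open>finite S\<close>, of q] by (simp add: S_def)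
  also have "ln \<dots> = (\<Sum>x\<in>S - {q}. ln (absv (x - q) ^ order x P))"
    using \<open>finite S\<close> by (intro ln_prod) (auto simp: absv_pos_iff)
  also have "\<dots> = (\<Sum>x\<in>S - {q}. real (order x P) * ln (absv (x - q)))"
    by (intro sum.cong) (simp_all add: ln_realpow absv_pos_iff)
  finally show ?thesis
    by (simp add: S P_def periodic_multiplicity_def)
qed

lemma absv_iterate_large:
  assumes "integral_poly f" "absv (lead_coeff f) = 1" "0 < degree f" "1 < absv q"
  shows "absv ((poly f ^^ n) q) = absv q ^ (degree f ^ n)"
  using absv_monic_poly_dominant[OF assms(4), of "iterate_poly f n"]
    integral_poly_iterate[OF assms(1), of n] absv_lead_coeff_iterate_poly[OF assms(2,3), of n]
  by (simp add: integral_poly_def degree_iterate_poly poly_iterate_poly)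

text \<open>An exact identity, so the approximants of the local height form a constant
  sequence.\<close>

lemma log_plus_iterate:
  assumes "integral_poly f" "absv (lead_coeff f) = 1" "0 < degree f"
  shows "log_plus (absv ((poly f ^^ n) q)) = real (degree f) ^ n * log_plus (absv q)"
proof (cases "1 < absv q")
  case True
  then have "0 \<le> ln (absv q)" by simp
  then show ?thesis
    using True by (simp add: absv_iterate_large[OF assms True] log_plus_def ln_realpow)
next
  case False
  then have *: "absv q \<le> 1" by simp
  moreover have "absv ((poly f ^^ n) q) \<le> 1"
    using absv_poly_le_1[OF integral_poly_iterate[OF assms(1)] *] by (simp add: poly_iterate_poly)
  moreover have "log_plus (absv x) = 0" if "absv x \<le> 1" for x
    using that absv_nonneg[of x] by (auto simp: log_plus_def max_def)
  ultimately show ?thesis by simp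
qed

lemma ln_leading_absv_iterate_tendsto:
  assumes "integral_poly f" "absv (lead_coeff f) = 1" "2 \<le> degree f"
  shows "(\<lambda>n. ln (leading_absv q (iterate_poly f n - [:0, 1:])) / real (degree f) ^ n)
    \<longlonglongrightarrow> log_plus (absv q)"
proof (cases "1 < absv q")
  case True
  have "ln (leading_absv q (iterate_poly f n - [:0, 1:])) / real (degree f) ^ n = log_plus (absv q)"
    if "0 < n" for n
  proof -
    \<comment> \<open>An exponent above 1 makes the iterate strictly dominate the subtracted
      \<open>q\<close>.\<close>
    have "2 \<le> degree f ^ n"
      using assms(3) that self_le_power[of "degree f" n] by simp
    then have "absv q ^ 1 < absv q ^ (degree f ^ n)"
      using True by (intro power_strict_increasing) simp_all
    then have "absv q < absv ((poly f ^^ n) q)"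
      using assms True by (simp add: absv_iterate_large)
    then have eq: "absv (poly (iterate_poly f n - [:0, 1:]) q) = absv ((poly f ^^ n) q)"
      using absv_add_eq[of "- q" "(poly f ^^ n) q"] by (simp add: poly_iterate_poly)
    then have "poly (iterate_poly f n - [:0, 1:]) q \<noteq> 0"
      using \<open>absv q < absv ((poly f ^^ n) q)\<close> True by auto
    from leading_absv_eq[OF this]
    have "leading_absv q (iterate_poly f n - [:0, 1:]) = absv q ^ (degree f ^ n)"
      using assms True by (simp only: eq absv_iterate_large)
    then show ?thesis
      using True assms(3) by (simp add: ln_realpow log_plus_def max_def)
  qed
  then have "\<forall>\<^sub>F n in sequentially. ln (leading_absv q (iterate_poly f n - [:0, 1:])) / real (degree f) ^ n
      = log_plus (absv q)"
    by (intro eventually_mono[OF eventually_gt_at_top[of 0]])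
  then show ?thesis by (rule tendsto_eventually)
next
  case False
  then have q: "absv q \<le> 1" by simp
  obtain c where c: "0 < c" "\<And>n. 0 < n \<Longrightarrow> c / real n \<le> leading_absv q (iterate_poly f n - [:0, 1:])"
    using leading_absv_iterate_ge[OF assms(1) q assms(3)] by blast
  have "log_plus (absv q) = 0"
    using q absv_nonneg[of q] by (auto simp: log_plus_def max_def)
  moreover have "(\<lambda>n. ln (leading_absv q (iterate_poly f n - [:0, 1:])) / real (degree f) ^ n) \<longlonglongrightarrow> 0"
  proof (rule tendsto_sandwich)
    have d: "1 < real (degree f)" using assms(3) by simp
    then show "(\<lambda>n. (ln c - ln (real n)) / real (degree f) ^ n) \<longlonglongrightarrow> 0"
      by real_asymp
    show "\<forall>\<^sub>F n in sequentially. (ln c - ln (real n)) / real (degree f) ^ n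
        \<le> ln (leading_absv q (iterate_poly f n - [:0, 1:])) / real (degree f) ^ n"
      using eventually_gt_at_top[of 0]
    proof eventually_elim
      case (elim n)
      have "ln c - ln (real n) = ln (c / real n)"
        using c(1) elim by (simp add: ln_div)
      also have "\<dots> \<le> ln (leading_absv q (iterate_poly f n - [:0, 1:]))"
        using c(1) c(2)[OF elim] elim by (intro ln_mono) simp_all
      finally show ?case by (simp add: divide_right_mono)
    qed
    show "\<forall>\<^sub>F n in sequentially. ln (leading_absv q (iterate_poly f n - [:0, 1:])) / real (degree f) ^ n \<le> 0"
      using eventually_gt_at_top[of 0]
    proof eventually_elim
      case (elim n)
      have "leading_absv q (iterate_poly f n - [:0, 1:]) \<le> 1"
        using assms(1) q by (intro leading_absv_le_1 integral_poly_diff integral_poly_iterate) simp_all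
      moreover have "0 < leading_absv q (iterate_poly f n - [:0, 1:])"
        using assms(3) elim by (intro leading_absv_pos iterate_poly_minus_X_neq_0)
      ultimately show ?case by (simp add: divide_nonpos_nonneg)
    qed
  qed simp
  ultimately show ?thesis by simp
qed

end

theorem theorem3p1:
  fixes p d :: nat and absv :: "'a::field_char_0 \<Rightarrow> real"
    and f :: "'a poly" and \<phi> :: "'a proj_line \<Rightarrow> 'a proj_line" and q :: 'a
  assumes "padic_complex_field p absv"
    and "degree f = d" and "d \<ge> 2"
    and "\<forall>i. coeff f i \<in> integral_elements absv"
    and "lead_coeff f \<in> integral_units absv"
    and "\<phi> = polynomial_morphism f"
  shows "convergent (local_height_approx absv \<phi> q)
    \<and> local_height absv \<phi> q = log_plus (absv q)
    \<and> (\<lambda>n. 1 / real d ^ n *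
          (\<Sum>\<xi> | \<xi> \<noteq> q \<and> (poly f ^^ n) \<xi> = \<xi>.
             real (periodic_multiplicity f n \<xi>) * ln (absv (\<xi> - q))))
        \<longlonglongrightarrow> log_plus (absv q)"
proof -
  interpret padic_complex_field p absv by (fact assms(1))
  have int: "integral_poly f"
    using assms(4) by (simp add: integral_poly_def integral_elements_def)
  obtain y where "absv (lead_coeff f) \<le> 1" "absv y \<le> 1" "lead_coeff f * y = 1"
    using assms(5) by (auto simp: integral_units_def integral_elements_def)
  \<comment> \<open>Two absolute values at most 1 with product 1 are both 1.\<close>
  then have lc: "absv (lead_coeff f) = 1"
    using absv_mult_le[of "lead_coeff f" "absv (lead_coeff f)" y 1] by simp
  have "local_height_approx absv \<phi> q = (\<lambda>_. log_plus (absv q))"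
    using log_plus_iterate[OF int lc] assms(2,3,6)
    by (intro ext) (simp add: local_height_approx_def)
  then have "local_height_approx absv \<phi> q \<longlonglongrightarrow> log_plus (absv q)"
    by simp
  moreover have "(\<lambda>n. 1 / real d ^ n *
      (\<Sum>\<xi> | \<xi> \<noteq> q \<and> (poly f ^^ n) \<xi> = \<xi>.
         real (periodic_multiplicity f n \<xi>) * ln (absv (\<xi> - q)))) \<longlonglongrightarrow> log_plus (absv q)"
  proof (rule Lim_transform_eventually)
    show "(\<lambda>n. ln (leading_absv q (iterate_poly f n - [:0, 1:])) / real (degree f) ^ n)
        \<longlonglongrightarrow> log_plus (absv q)"
      using int lc assms(2,3) by (intro ln_leading_absv_iterate_tendsto) simp_all
    show "\<forall>\<^sub>F n in sequentially. ln (leading_absv q (iterate_poly f n - [:0, 1:])) / real (degree f) ^ n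
        = 1 / real d ^ n * (\<Sum>\<xi> | \<xi> \<noteq> q \<and> (poly f ^^ n) \<xi> = \<xi>.
            real (periodic_multiplicity f n \<xi>) * ln (absv (\<xi> - q)))"
      \<comment> \<open>At \<open>n = 0\<close> every point is fixed and the sum over an infinite
        set has the default value 0; the limit ignores this index.\<close>
      using eventually_gt_at_top[of 0]
    proof eventually_elim
      case (elim n)
      then show ?case
        using periodic_sum_eq[OF lc _ elim, of q] assms(2,3) by simp
    qed
  qed
  ultimately show ?thesis
    unfolding local_height_def by (auto intro: convergentI limI)
qed

end
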